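(* The $(5,4)$-spectrum is the set of all even integers greater than or equal to $10$, that is, $\{10,12,14,\dots\}$, and $N(5,4)$ is equal to the Moore bound $M(5,4)=10$.
   Context: Graphs are finite and simple. For integers $k\ge 3$, $g\ge 3$, a $(k,g)$-graph is a $k$-regular graph of girth exactly $g$. The $(k,g)$-spectrum is the set of all integers $n$ such that there exists a connected $(k,g)$-graph of order $n$. For odd $k$, $N(k,g)$ denotes the smallest element $N$ of the $(k,g)$-spectrum such that all even integers $n\ge N$ belong to the $(k,g)$-spectrum. The Moore bound is $M(k,g)=1+\sum_{i=0}^{(g-3)/2}k(k-1)^i$ for $g$ odd and $M(k,g)=2\sum_{i=0}^{(g-2)/2}(k-1)^i$ for $g$ even. *)

theory Defs
  imports "Graph_Theory.Graph_Theory" "HOL-Library.Extended_Nat"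
begin

text \<open>
  A finite simple graph is a \<^locale>\<open>pair_graph\<close>: finite vertex set, and a symmetric loop-free
  set of arcs, so that each undirected edge is a pair of opposite arcs and the degree of a
  vertex is its out-degree.
\<close>

definition regular :: "nat \<Rightarrow> 'a pair_pre_digraph \<Rightarrow> bool" where
  "regular k G \<longleftrightarrow> (\<forall>v \<in> pverts G. out_degree (with_proj G) v = k)"

text \<open>
  The library's notion of cycle is the directed one, for which going along an edge and back
  is a cycle of length 2. In a simple graph, the directed cycles of length at least 3 are exactly
  the traversals of the undirected cycles. The girth of an acyclic graph is \<open>\<infinity>\<close>.
\<close>

definition girth :: "'a pair_pre_digraph \<Rightarrow> enat" where
  "girth G = (INF p \<in> {p. pre_digraph.cycle (with_proj G) p \<and> 3 \<le> length p}. enat (length p))"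

definition kg_graph :: "nat \<Rightarrow> nat \<Rightarrow> 'a pair_pre_digraph \<Rightarrow> bool" where
  "kg_graph k g G \<longleftrightarrow> pair_graph G \<and> regular k G \<and> girth G = enat g"

text \<open>
  Graphs being finite, vertices can be taken to be natural numbers without loss of generality.
  Note that \<^const>\<open>connected\<close> excludes the null graph. Only \<open>k \<ge> 3\<close> and \<open>g \<ge> 3\<close> are of interest.
\<close>

definition spectrum :: "nat \<Rightarrow> nat \<Rightarrow> nat set" where
  "spectrum k g =
     {n. \<exists>G :: nat pair_pre_digraph. kg_graph k g G \<and> connected (with_proj G) \<and> card (pverts G) = n}"

text \<open>Only meaningful for odd \<open>k\<close>, where every order in the spectrum is even.\<close>

definition N_kg :: "nat \<Rightarrow> nat \<Rightarrow> nat" where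
  "N_kg k g = (LEAST N. N \<in> spectrum k g \<and> (\<forall>n \<ge> N. even n \<longrightarrow> n \<in> spectrum k g))"

definition moore_bound :: "nat \<Rightarrow> nat \<Rightarrow> nat" where
  "moore_bound k g =
     (if odd g then 1 + (\<Sum>i = 0..(g - 3) div 2. k * (k - 1) ^ i)
      else 2 * (\<Sum>i = 0..(g - 2) div 2. (k - 1) ^ i))"

end

theory Submission
  imports Defs "HOL-Library.Z2" "HOL-Library.Disjoint_Sets"
begin

text \<open>
  For odd \<open>k \<ge> 3\<close> the \<open>(k,4)\<close>-spectrum consists of all even \<open>n \<ge> 2k\<close>, and the theorem is the
  case \<open>k = 5\<close>.

  No other order occurs. The degree sum \<open>k n\<close> is twice the number of edges, so \<open>n\<close> is even
  (\<open>even_card_parcs\<close>). A graph of girth 4 has no triangle, so the ends of an edge have disjoint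
  neighbourhoods, which together contain \<open>2k\<close> vertices (\<open>card_pverts_ge\<close>).

  All of these orders occur. For even \<open>n \<ge> 2k\<close>, place \<open>0, \<dots>, n - 1\<close> around a circle
  and join every even vertex to the \<open>k\<close> odd vertices following it most closely; the distances are \<open>1, 3, \<dots>, 2k - 1\<close>. Because
  \<open>2k \<le> n\<close>, these neighbours are distinct, and an odd vertex is joined to the \<open>k\<close> even vertices
  preceding it most closely. The graph is bipartite, hence has no triangle. From \<open>k \<ge> 2\<close> it follows
  that \<open>u\<close> and \<open>u + 2\<close> have the common neighbour \<open>u + 3\<close>, so the graph is connected; from \<open>k \<ge> 3\<close>
  that \<open>0, 3, 2, 5\<close> is a cycle.
\<close>

section \<open>Triangles and quadrilaterals\<close>

lemma (in pair_loopfree_digraph) girth_4_imp_no_triangle: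
  assumes girth: "girth G = 4" and arcs: "(a, b) \<in> parcs G" "(b, c) \<in> parcs G"
  shows "(c, a) \<notin> parcs G"
proof
  assume "(c, a) \<in> parcs G"
  let ?p = "[(a, b), (b, c), (c, a)]"
  have "awalk a ?p a"
    using arcs \<open>(c, a) \<in> parcs G\<close> by (auto simp: awalk_def dest: in_arcsD1)
  moreover have "distinct (tl (pawalk_verts a ?p))"
    using no_loops'[OF arcs(1)] no_loops'[OF arcs(2)] no_loops'[OF \<open>(c, a) \<in> parcs G\<close>] by auto
  ultimately have "cycle ?p"
    unfolding cycle_def by auto
  then have "girth G \<le> enat (length ?p)"
    unfolding girth_def by (intro INF_lower) auto
  with girth show False
    by (simp add: numeral_eq_enat)
qed

lemma (in pair_wf_digraph) girth_eq_4I: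
  assumes no_triangle: "\<And>a b c. (a, b) \<in> parcs G \<Longrightarrow> (b, c) \<in> parcs G \<Longrightarrow> (c, a) \<notin> parcs G"
    and arcs: "(a, b) \<in> parcs G" "(b, c) \<in> parcs G" "(c, d) \<in> parcs G" "(d, a) \<in> parcs G"
    and "distinct [a, b, c, d]"
  shows "girth G = 4"
proof (rule antisym)
  let ?p = "[(a, b), (b, c), (c, d), (d, a)]"
  have "awalk a ?p a"
    using arcs by (auto simp: awalk_def dest: in_arcsD1)
  then have "cycle ?p"
    using \<open>distinct [a, b, c, d]\<close> unfolding cycle_def by auto
  then have "girth G \<le> enat (length ?p)"
    unfolding girth_def by (intro INF_lower) auto
  then show "girth G \<le> 4"
    by (simp add: numeral_eq_enat eval_nat_numeral)
next
  show "4 \<le> girth G"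
    unfolding girth_def
  proof (rule INF_greatest)
    fix p assume "p \<in> {p. cycle p \<and> 3 \<le> length p}"
    then have "cycle p" "3 \<le> length p" by auto
    have "length p \<noteq> 3"
    proof
      assume "length p = 3"
      then obtain e1 e2 e3 where p: "p = [e1, e2, e3]"
        by (auto simp: numeral_3_eq_3 length_Suc_conv)
      obtain u where "pcas u p u" "set p \<subseteq> parcs G"
        using \<open>cycle p\<close> unfolding cycle_def awalk_def by blast
      then have "fst e1 = u" "fst e2 = snd e1" "fst e3 = snd e2" "snd e3 = u"
        and "e1 \<in> parcs G" "e2 \<in> parcs G" "e3 \<in> parcs G"
        unfolding p by simp_all
      then have "(u, snd e1) \<in> parcs G" "(snd e1, snd e2) \<in> parcs G" "(snd e2, u) \<in> parcs G"
        by (metis prod.collapse)+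
      then show False
        using no_triangle by blast
    qed
    with \<open>3 \<le> length p\<close> show "4 \<le> enat (length p)"
      by (simp add: numeral_eq_enat)
  qed
qed

section \<open>Necessary conditions on the order\<close>

text \<open>
  Reversing arcs is an involution without fixed points. Summing \<open>1\<close> over all arcs modulo 2, the two
  arcs of each edge cancel.
\<close>

lemma (in pair_bidirected_digraph) even_card_parcs: "even (card (parcs G))"
proof -
  have "(\<Sum>e\<in>parcs G. 1 :: bit) = 0"
  proof (rule sum_involution_eq_0[where h = prod.swap])
    fix e assume e: "e \<in> parcs G"
    then show "prod.swap e \<in> parcs G"
      using arcs_symmetric[of "fst e" "snd e"] by (simp add: prod.swap_def)
    show "prod.swap e \<noteq> e"
      using pair_no_loops[OF e] by (simp add: prod.swap_def prod_eq_iff)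
  qed simp_all
  then have "even (of_nat (card (parcs G)) :: bit)"
    by simp
  then show ?thesis
    by (simp only: even_of_nat_iff)
qed

lemma out_degree_with_proj: "out_degree (with_proj G) v = card {w. (v, w) \<in> parcs G}"
proof -
  have "out_arcs (with_proj G) v = Pair v ` {w. (v, w) \<in> parcs G}"
    by auto
  then show ?thesis
    unfolding out_degree_def by (simp add: card_image inj_on_def)
qed

lemma (in pair_fin_digraph) card_parcs_regular:
  assumes "regular k G"
  shows "card (parcs G) = k * card (pverts G)"
proof -
  let ?N = "\<lambda>v. {w. (v, w) \<in> parcs G}"
  have fin_N: "finite (?N v)" for v
    by (rule finite_subset[OF _ pair_finite_verts]) (auto dest: in_arcsD2)
  have "parcs G = Sigma (pverts G) ?N"
    by (auto dest: in_arcsD1)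
  then have "card (parcs G) = (\<Sum>v\<in>pverts G. card (?N v))"
    using card_SigmaI[of "pverts G" ?N] pair_finite_verts fin_N by metis
  also have "\<dots> = (\<Sum>v\<in>pverts G. k)"
    using assms by (intro sum.cong) (auto simp: regular_def out_degree_with_proj)
  finally show ?thesis by simp
qed

lemma (in pair_graph) card_pverts_ge:
  assumes "regular k G" "girth G = 4" "k > 0" "pverts G \<noteq> {}"
  shows "2 * k \<le> card (pverts G)"
proof -
  let ?N = "\<lambda>v. {w. (v, w) \<in> parcs G}"
  have N_subset: "?N v \<subseteq> pverts G" for v
    by (auto dest: in_arcsD2)
  have fin_N: "finite (?N v)" for v
    using N_subset pair_finite_verts by (rule finite_subset)
  have card_N: "card (?N v) = k" if "v \<in> pverts G" for v
    using that \<open>regular k G\<close> by (simp add: regular_def out_degree_with_proj)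
  obtain u where u: "u \<in> pverts G"
    using \<open>pverts G \<noteq> {}\<close> by auto
  then have "?N u \<noteq> {}"
    using card_N \<open>k > 0\<close> by fastforce
  then obtain v where uv: "(u, v) \<in> parcs G"
    by auto
  then have v: "v \<in> pverts G"
    by (rule in_arcsD2)
  have "?N u \<inter> ?N v = {}"
    using girth_4_imp_no_triangle[OF \<open>girth G = 4\<close> uv] arcs_symmetric by blast
  then have "card (?N u \<union> ?N v) = 2 * k"
    using card_Un_disjoint[OF fin_N fin_N] card_N[OF u] card_N[OF v] by simp
  moreover have "card (?N u \<union> ?N v) \<le> card (pverts G)"
    by (intro card_mono pair_finite_verts Un_least N_subset)
  ultimately show ?thesis by simp
qed

lemma spectrum_4_subset:
  assumes "odd k"
  shows "spectrum k 4 \<subseteq> {n. even n \<and> n \<ge> 2 * k}"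
proof
  fix n assume "n \<in> spectrum k 4"
  then obtain G :: "nat pair_pre_digraph" where G: "pair_graph G" "regular k G" "girth G = 4"
    "connected (with_proj G)" and n: "card (pverts G) = n"
    by (auto simp: spectrum_def kg_graph_def numeral_eq_enat)
  interpret pair_graph G by fact
  have "even (k * n)"
    using even_card_parcs card_parcs_regular[OF G(2)] n by simp
  moreover have "pverts G \<noteq> {}"
    using G(4) by (simp add: connected_conv)
  ultimately show "n \<in> {n. even n \<and> n \<ge> 2 * k}"
    using card_pverts_ge[OF G(2,3) odd_pos[OF \<open>odd k\<close>]] n \<open>odd k\<close> by simp
qed

section \<open>A bipartite graph on a circle\<close>

text \<open>
  For even \<open>u\<close> and odd \<open>v\<close> below an even \<open>n \<ge> 2k\<close>, this says that going from \<open>u\<close> to \<open>v\<close> in the positive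
  direction around the circle of length \<open>n\<close> takes less than \<open>2k\<close> steps; the second disjunct is the
  case of passing through \<open>0\<close>. Avoiding \<open>mod\<close> keeps everything linear.
\<close>

definition follows :: "nat \<Rightarrow> nat \<Rightarrow> nat \<Rightarrow> nat \<Rightarrow> bool" where
  "follows k n u v \<longleftrightarrow> even u \<and> odd v \<and> (u < v \<and> v < u + 2 * k \<or> v + n < u + 2 * k)"

definition circle_graph :: "nat \<Rightarrow> nat \<Rightarrow> nat pair_pre_digraph" where
  "circle_graph k n = \<lparr> pverts = {..<n},
     parcs = {(u, v). u < n \<and> v < n \<and> (follows k n u v \<or> follows k n v u)} \<rparr>"

lemma circle_graph_simps [simp]:
  "pverts (circle_graph k n) = {..<n}"
  "(u, v) \<in> parcs (circle_graph k n) \<longleftrightarrow> u < n \<and> v < n \<and> (follows k n u v \<or> follows k n v u)"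
  by (simp_all add: circle_graph_def)

lemma pair_graph_circle_graph: "pair_graph (circle_graph k n)"
proof
  have "parcs (circle_graph k n) \<subseteq> {..<n} \<times> {..<n}"
    by auto
  then show "finite (parcs (circle_graph k n))"
    by (rule finite_subset) simp
  show "symmetric (with_proj (circle_graph k n))"
    by (auto simp: symmetric_def sym_def)
qed (auto simp: follows_def)

text \<open>
  Halving all vertices removes parity from the counting below, where the neighbours are listed by
  adding or subtracting \<open>0, \<dots>, k - 1\<close> modulo \<open>m = n / 2\<close>.
\<close>

lemma follows_double:
  "follows k (2 * m) (2 * a) (2 * b + 1) \<longleftrightarrow> a \<le> b \<and> b < a + k \<or> b + m < a + k"
proof -
  have "2 * b + 1 + 2 * m < 2 * a + 2 * k \<longleftrightarrow> b + m < a + k"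
    "2 * a < 2 * b + 1 \<and> 2 * b + 1 < 2 * a + 2 * k \<longleftrightarrow> a \<le> b \<and> b < a + k"
    by linarith+
  then show ?thesis
    by (simp only: follows_def) simp
qed

lemma card_follows_forward:
  assumes "even n" "2 * k \<le> n" "u < n" "even u"
  shows "card {v. v < n \<and> follows k n u v} = k"
proof -
  obtain m a where n: "n = 2 * m" and u: "u = 2 * a"
    using assms by (auto elim!: evenE)
  have "k \<le> m" "a < m"
    using assms n u by auto
  let ?g = "\<lambda>i. if a + i < m then a + i else a + i - m"
  have inj: "inj_on (\<lambda>i. 2 * ?g i + 1) {..<k}"
  proof (rule inj_onI)
    fix i j assume "i \<in> {..<k}" "j \<in> {..<k}" "2 * ?g i + 1 = 2 * ?g j + 1"
    then have "i < k" "j < k" "?g i = ?g j"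
      by auto
    with \<open>k \<le> m\<close> show "i = j"
      by (cases "a + i < m"; cases "a + j < m") simp_all
  qed
  have "{v. v < n \<and> follows k n u v} = (\<lambda>i. 2 * ?g i + 1) ` {..<k}"
  proof (intro equalityI subsetI)
    fix v assume "v \<in> (\<lambda>i. 2 * ?g i + 1) ` {..<k}"
    then obtain i where i: "i < k" and v: "v = 2 * ?g i + 1"
      by auto
    have "?g i < m" "a \<le> ?g i \<and> ?g i < a + k \<or> ?g i + m < a + k"
      using i \<open>k \<le> m\<close> \<open>a < m\<close> by (cases "a + i < m"; simp)+
    then show "v \<in> {v. v < n \<and> follows k n u v}"
      unfolding mem_Collect_eq n u v follows_double by linarith
  next
    fix v assume "v \<in> {v. v < n \<and> follows k n u v}"
    then have "v < n" "follows k n u v" by auto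
    moreover from this obtain b where v: "v = 2 * b + 1"
      by (auto simp: follows_def elim: oddE)
    ultimately have b: "b < m" "a \<le> b \<and> b < a + k \<or> b + m < a + k"
      unfolding n u v follows_double by linarith+
    define i where "i = (if a \<le> b then b - a else b + m - a)"
    have "i < k" "?g i = b"
      using b \<open>k \<le> m\<close> \<open>a < m\<close> unfolding i_def by (cases "a \<le> b"; simp; linarith)+
    then show "v \<in> (\<lambda>i. 2 * ?g i + 1) ` {..<k}"
      unfolding v by (intro image_eqI[of _ _ i]) simp_all
  qed
  then show ?thesis
    using inj by (simp add: card_image)
qed

lemma card_follows_backward:
  assumes "even n" "2 * k \<le> n" "v < n" "odd v"
  shows "card {u. u < n \<and> follows k n u v} = k"
proof -
  obtain m b where n: "n = 2 * m" and v: "v = 2 * b + 1"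
    using assms by (auto elim!: evenE oddE)
  have "k \<le> m" "b < m"
    using assms n v by auto
  let ?g = "\<lambda>i. if i \<le> b then b - i else b + m - i"
  have inj: "inj_on (\<lambda>i. 2 * ?g i) {..<k}"
  proof (rule inj_onI)
    fix i j assume "i \<in> {..<k}" "j \<in> {..<k}" "2 * ?g i = 2 * ?g j"
    then have "i < k" "j < k" "?g i = ?g j"
      by auto
    with \<open>k \<le> m\<close> show "i = j"
      by (cases "i \<le> b"; cases "j \<le> b") simp_all
  qed
  have "{u. u < n \<and> follows k n u v} = (\<lambda>i. 2 * ?g i) ` {..<k}"
  proof (intro equalityI subsetI)
    fix u assume "u \<in> (\<lambda>i. 2 * ?g i) ` {..<k}"
    then obtain i where i: "i < k" and u: "u = 2 * ?g i"
      by auto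
    have "?g i < m" "?g i \<le> b \<and> b < ?g i + k \<or> b + m < ?g i + k"
      using i \<open>k \<le> m\<close> \<open>b < m\<close> by (cases "i \<le> b"; simp; linarith)+
    then show "u \<in> {u. u < n \<and> follows k n u v}"
      unfolding mem_Collect_eq n u v follows_double by linarith
  next
    fix u assume "u \<in> {u. u < n \<and> follows k n u v}"
    then have "u < n" "follows k n u v" by auto
    moreover from this obtain a where u: "u = 2 * a"
      by (auto simp: follows_def elim: evenE)
    ultimately have a: "a < m" "a \<le> b \<and> b < a + k \<or> b + m < a + k"
      unfolding n u v follows_double by linarith+
    define i where "i = (if a \<le> b then b - a else b + m - a)"
    have "i < k" "?g i = a"
      using a \<open>k \<le> m\<close> \<open>b < m\<close> unfolding i_def by (cases "a \<le> b"; simp; linarith)+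
    then show "u \<in> (\<lambda>i. 2 * ?g i) ` {..<k}"
      unfolding u by (intro image_eqI[of _ _ i]) simp_all
  qed
  then show ?thesis
    using inj by (simp add: card_image)
qed

lemma regular_circle_graph:
  assumes "even n" "2 * k \<le> n"
  shows "regular k (circle_graph k n)"
  unfolding regular_def out_degree_with_proj
proof
  fix v assume "v \<in> pverts (circle_graph k n)"
  then have v: "v < n" by simp
  have "{w. (v, w) \<in> parcs (circle_graph k n)} =
      (if even v then {w. w < n \<and> follows k n v w} else {w. w < n \<and> follows k n w v})"
    using v by (auto simp: follows_def)
  then show "card {w. (v, w) \<in> parcs (circle_graph k n)} = k"
    using card_follows_forward[OF assms v] card_follows_backward[OF assms v] by simp
qed

lemma girth_circle_graph:
  assumes "k \<ge> 3" "2 * k \<le> n"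
  shows "girth (circle_graph k n) = 4"
proof -
  interpret pair_graph "circle_graph k n"
    by (rule pair_graph_circle_graph)
  show ?thesis
  proof (rule girth_eq_4I)
    \<comment> \<open>Adjacent vertices have different parity.\<close>
    show "(c, a) \<notin> parcs (circle_graph k n)"
      if "(a, b) \<in> parcs (circle_graph k n)" "(b, c) \<in> parcs (circle_graph k n)" for a b c
      using that by (auto simp: follows_def)
    show "(0, 3) \<in> parcs (circle_graph k n)" "(3, 2) \<in> parcs (circle_graph k n)"
      "(2, 5) \<in> parcs (circle_graph k n)" "(5, 0) \<in> parcs (circle_graph k n)"
      using assms by (auto simp: follows_def)
  qed simp
qed

lemma connected_circle_graph:
  assumes "k \<ge> 2" "even n" "2 * k \<le> n"
  shows "connected (with_proj (circle_graph k n))"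
proof -
  interpret pair_graph "circle_graph k n"
    by (rule pair_graph_circle_graph)
  let ?G = "with_proj (circle_graph k n)"
  have even_vertex: "2 * i < n \<Longrightarrow> 0 \<rightarrow>\<^sup>*\<^bsub>?G\<^esub> (2 * i)" for i
  proof (induction i)
    case 0
    then show ?case by simp
  next
    case (Suc i)
    then have "2 * i < n" "2 * i + 3 < n"
      using \<open>even n\<close> by (simp, presburger)
    then have "(2 * i, 2 * i + 3) \<in> parcs (circle_graph k n)"
      "(2 * i + 3, 2 * Suc i) \<in> parcs (circle_graph k n)"
      using \<open>k \<ge> 2\<close> by (auto simp: follows_def)
    with Suc.IH[OF \<open>2 * i < n\<close>] show ?case
      by (meson reachable_adj_trans)
  qed
  have from_0: "0 \<rightarrow>\<^sup>*\<^bsub>?G\<^esub> v" if "v < n" for v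
  proof (cases "even v")
    case True
    then show ?thesis using even_vertex that by (auto elim: evenE)
  next
    case False
    then obtain i where i: "v = 2 * i + 1" by (auto elim: oddE)
    have "(2 * i, v) \<in> parcs (circle_graph k n)"
      using that i \<open>k \<ge> 2\<close> by (auto simp: follows_def)
    moreover have "2 * i < n"
      using that i by simp
    ultimately show ?thesis
      using even_vertex by (meson reachable_adj_trans)
  qed
  have "(u, v) \<in> rtrancl_on {..<n} ((parcs (circle_graph k n))\<^sup>s)" if "u < n" "v < n" for u v
  proof -
    have "u \<rightarrow>\<^sup>*\<^bsub>?G\<^esub> v"
      using symmetric_reachable[OF pair_sym_arcs] from_0 that by (blast intro: reachable_trans)
    then show ?thesis
      unfolding reachable_def by (rule rtrancl_on_mono[rotated 2]) (auto simp: symcl_def)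
  qed
  then show ?thesis
    using assms by (auto simp: connected_conv lessThan_empty_iff)
qed

section \<open>The spectrum\<close>

lemma spectrum_4:
  assumes "odd k" "k \<ge> 3"
  shows "spectrum k 4 = {n. even n \<and> n \<ge> 2 * k}"
proof
  show "{n. even n \<and> n \<ge> 2 * k} \<subseteq> spectrum k 4"
  proof
    fix n assume "n \<in> {n. even n \<and> n \<ge> 2 * k}"
    then have "even n" "2 * k \<le> n" by auto
    then have "kg_graph k 4 (circle_graph k n)" "connected (with_proj (circle_graph k n))"
      using assms pair_graph_circle_graph regular_circle_graph girth_circle_graph
        connected_circle_graph
      by (auto simp: kg_graph_def numeral_eq_enat)
    then show "n \<in> spectrum k 4"
      unfolding spectrum_def by (auto intro!: exI[of _ "circle_graph k n"])
  qed
qed (rule spectrum_4_subset[OF \<open>odd k\<close>])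

theorem mainTheorem14:
  shows "spectrum 5 4 = {n. even n \<and> n \<ge> 10} \<and>
    N_kg 5 4 = moore_bound 5 4 \<and> moore_bound 5 4 = 10"
proof -
  have spectrum: "spectrum 5 4 = {n. even n \<and> n \<ge> 10}"
    using spectrum_4[of 5] by simp
  have "N_kg 5 4 = 10"
    unfolding N_kg_def spectrum by (rule Least_equality) auto
  moreover have "moore_bound 5 4 = 10"
    by (simp add: moore_bound_def)
  ultimately show ?thesis
    using spectrum by simp
qed

end
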